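(* Let $F$ be a field, $E/F$ a quadratic field extension with nontrivial automorphism $\sigma$, let $\omega\in E\setminus F$ be fixed, and let $A=E\oplus E$ be the four-dimensional $F$-algebra with multiplication $$(a,b)(c,d)=(ac+\omega b^{\sigma}d,\; bc+a^{\sigma}d).$$ Regard $A$ as a two-sided vector space over $E$ by $$k(a,b)=(ka,k^{\sigma}b),\qquad (a,b)k=(ak,bk)\qquad (k\in E).$$ Let $x,y,x',y'\in A$ be nonzero elements. Then $A(x,y)=A(x',y')$ if and only if one of the following holds: (i) $x'=lx$, $y'=ly$ for some $l\in E^{\times}$. (ii) $x=ym$, $x'=y'm$ for some $m\in E^{\times}$.
   Context: The base field $F$ has arbitrary characteristic. An algebra is an $F$-vector space with bilinear, not necessarily associative, multiplication. The algebra $A$ acts on $A^2=A\oplus A$ by $a(x,y)=(ax,ay)$, and $A(x,y)=\{(ax,ay)\mid a\in A\}\subset A^2$. *)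

theory Defs
  imports Complex_Main "HOL-Library.Product_Plus"
begin

text \<open>
  A quadratic field extension \<open>E/F\<close> with its nontrivial automorphism \<open>\<sigma>\<close>. The fields are the types
  \<open>'f\<close> and \<open>'e\<close>; the embedding \<open>\<iota>\<close> makes \<open>'e\<close> an extension of \<open>'f\<close>, so that \<open>F\<close> as a subfield
  of \<open>E\<close> is \<open>range \<iota>\<close>. The constant \<open>vector_space.dim\<close> is 0 on infinite-dimensional spaces, so the
  value 2 includes finite-dimensionality. \<open>E/F\<close> is automatically separable, as \<open>\<sigma> \<noteq> id\<close>.
\<close>

locale quadratic_extension =
  fixes \<iota> :: "'f::field \<Rightarrow> 'e::field"
    and \<sigma> :: "'e \<Rightarrow> 'e"
  assumes embedding_one: "\<iota> 1 = 1"
    and embedding_add: "\<iota> (r + s) = \<iota> r + \<iota> s"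
    and embedding_mult: "\<iota> (r * s) = \<iota> r * \<iota> s"
    and degree: "vector_space.dim (\<lambda>r a. \<iota> r * a) (UNIV :: 'e set) = 2"
    and aut_bij: "bij \<sigma>"
    and aut_add: "\<sigma> (a + b) = \<sigma> a + \<sigma> b"
    and aut_mult: "\<sigma> (a * b) = \<sigma> a * \<sigma> b"
    and aut_fixes: "\<sigma> (\<iota> r) = \<iota> r"
    and aut_nontrivial: "\<sigma> \<noteq> id"

definition A_mult :: "('e::field \<Rightarrow> 'e) \<Rightarrow> 'e \<Rightarrow> 'e \<times> 'e \<Rightarrow> 'e \<times> 'e \<Rightarrow> 'e \<times> 'e" where
  "A_mult \<sigma> \<omega> = (\<lambda>(a, b) (c, d). (a * c + \<omega> * \<sigma> b * d, b * c + \<sigma> a * d))"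

definition A_lscale :: "('e::field \<Rightarrow> 'e) \<Rightarrow> 'e \<Rightarrow> 'e \<times> 'e \<Rightarrow> 'e \<times> 'e" where
  "A_lscale \<sigma> k = (\<lambda>(a, b). (k * a, \<sigma> k * b))"

definition A_rscale :: "'e \<times> 'e \<Rightarrow> 'e \<Rightarrow> 'e::field \<times> 'e" where
  "A_rscale = (\<lambda>(a, b) k. (a * k, b * k))"

definition A_scale :: "('f::field \<Rightarrow> 'e::field) \<Rightarrow> 'f \<Rightarrow> 'e \<times> 'e \<Rightarrow> 'e \<times> 'e" where
  "A_scale \<iota> r = (\<lambda>(a, b). (\<iota> r * a, \<iota> r * b))"

text \<open>The action \<open>a(x, y) = (ax, ay)\<close> of an algebra with multiplication \<open>m\<close> on pairs.\<close>

definition pair_action :: "('a \<Rightarrow> 'a \<Rightarrow> 'a) \<Rightarrow> 'a \<Rightarrow> 'a \<times> 'a \<Rightarrow> 'a \<times> 'a" where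
  "pair_action m a = (\<lambda>(x, y). (m a x, m a y))"

definition pair_orbit :: "('a \<Rightarrow> 'a \<Rightarrow> 'a) \<Rightarrow> 'a \<times> 'a \<Rightarrow> ('a \<times> 'a) set" where
  "pair_orbit m p = {pair_action m a p | a. True}"

text \<open>
  \<open>A\<close> is an algebra over \<open>F\<close>, i.e. an \<open>F\<close>-vector space with bilinear multiplication, and both
  \<open>E\<close>-actions extend the scalar multiplication by \<open>F\<close>.
\<close>

context quadratic_extension
begin

lemma A_vector_space: "vector_space (A_scale \<iota>)"
  by unfold_locales
    (auto simp: A_scale_def embedding_one embedding_add embedding_mult algebra_simps)

lemma A_mult_bilinear:
  "A_mult \<sigma> \<omega> (p + q) u = A_mult \<sigma> \<omega> p u + A_mult \<sigma> \<omega> q u"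
  "A_mult \<sigma> \<omega> p (u + v) = A_mult \<sigma> \<omega> p u + A_mult \<sigma> \<omega> p v"
  "A_mult \<sigma> \<omega> (A_scale \<iota> r p) u = A_scale \<iota> r (A_mult \<sigma> \<omega> p u)"
  "A_mult \<sigma> \<omega> p (A_scale \<iota> r u) = A_scale \<iota> r (A_mult \<sigma> \<omega> p u)"
  by (auto simp: A_mult_def A_scale_def aut_add aut_mult aut_fixes algebra_simps split: prod.splits)

lemma A_scale_eq:
  "A_lscale \<sigma> (\<iota> r) p = A_scale \<iota> r p"
  "A_rscale p (\<iota> r) = A_scale \<iota> r p"
  by (auto simp: A_lscale_def A_rscale_def A_scale_def aut_fixes mult.commute split: prod.splits)

end

end

theory Submission
  imports Defs
begin

text \<open>
  For \<open>x \<noteq> 0\<close> the right multiplication by \<open>x = (c, d)\<close> is bijective: it is \<open>E\<close>-linear for the left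
  \<open>E\<close>-structure, and in the coordinates \<open>(a, \<sigma> b)\<close> it has determinant \<open>c \<sigma>(c) - \<omega> d \<sigma>(d)\<close>. This is
  nonzero, because \<open>1\<close> and \<open>\<omega>\<close> are linearly independent over \<open>F\<close>. Hence \<open>A(x, y)\<close> is the graph of
  the linear map ``divide by \<open>x\<close> on the right, then multiply by \<open>y\<close>'' (\<open>pair_orbit_iff\<close>), and two orbits
  coincide exactly when these maps have the same \<open>2 \<times> 2\<close> matrix. With \<open>y = (e, f)\<close> and up to
  the common denominator, the diagonal entries are values of the sesquilinear form
  \<open>\<sigma>(c) e - \<omega> \<sigma>(d) f\<close>, and the other two are \<open>\<omega>\<close> times the alternating form \<open>c f - d e\<close> and the
  conjugate of that form. Thus an equality of orbits means that, from \<open>(x, y)\<close> to \<open>(x', y')\<close>, the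
  denominator and all these values are multiplied by one scalar \<open>t\<close>.

  If the alternating form vanishes, then \<open>x = y m\<close> and \<open>x' = y' m'\<close>, and a diagonal entry gives
  \<open>m = m'\<close>, which is case (ii). Otherwise \<open>t\<close> is fixed by \<open>\<sigma>\<close>, because the alternating form and its
  conjugate are both multiplied by \<open>t\<close>. So one can compare coefficients of \<open>1\<close> and \<open>\<omega>\<close>
  (\<open>herm_coefficients\<close>): the first coordinates are multiplied by some \<open>l\<close> and the second ones by
  some \<open>k\<close>, both of norm \<open>t\<close>. The alternating form is then multiplied by \<open>k l\<close> and by \<open>t = \<sigma>(l) l\<close>,
  whence \<open>k = \<sigma>(l)\<close>, which is case (i). If one coordinate vanishes in \<open>x\<close>, the alternating form alone
  gives its factor.

  For the converse, in case (i) the factor \<open>l\<close> moves to the left factor, \<open>a (l x) = (a l) x\<close>, and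
  \<open>a \<mapsto> a l\<close> is bijective. In case (ii) both orbits consist of all pairs \<open>(z m, z)\<close>.

  About \<open>E/F\<close> the argument needs two things only: \<open>\<sigma>\<close> is an involution and it moves \<open>\<omega>\<close>.
\<close>

section \<open>The automorphism of a quadratic extension\<close>

context quadratic_extension
begin

lemma vector_space_E: "vector_space (\<lambda>r a. \<iota> r * a)"
  by unfold_locales (auto simp: embedding_one embedding_add embedding_mult algebra_simps)

text \<open>The set \<open>{1, u}\<close> is linearly independent and has as many elements as the degree.\<close>

lemma basis_one_and:
  assumes "u \<notin> range \<iota>"
  obtains p q where "a = \<iota> p + \<iota> q * u"
proof -
  interpret V: vector_space "\<lambda>r a. \<iota> r * a" by (rule vector_space_E)
  have "u \<noteq> 1" using assms embedding_one by (metis rangeI)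
  have "u \<notin> V.span {1}"
    using assms by (auto simp: V.span_singleton)
  moreover have "V.independent {1}"
    by (simp add: V.independent_insert)
  ultimately have ind: "V.independent {u, 1}"
    using \<open>u \<noteq> 1\<close> by (simp add: V.independent_insert)
  obtain B where B: "V.independent B" "V.span B = UNIV" "card B = 2"
    using V.basis_exists[of UNIV] degree by (metis top.extremum_uniqueI)
  \<comment> \<open>infinite sets have cardinality 0\<close>
  have finB: "finite B" using B(3) card.infinite by fastforce
  have "a \<in> V.span {u, 1}"
  proof (rule ccontr)
    assume a: "a \<notin> V.span {u, 1}"
    then have "a \<notin> {u, 1}" using V.span_base by blast
    then have "V.independent {a, u, 1}" using a ind by (simp add: V.independent_insert)
    then have "card {a, u, 1} \<le> card B"
      using V.independent_span_bound[OF finB] B(2) by auto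
    then show False using \<open>a \<notin> {u, 1}\<close> \<open>u \<noteq> 1\<close> B(3) by simp
  qed
  then obtain q where "a - \<iota> q * u \<in> V.span {1}"
    by (auto simp: V.span_insert[of u])
  then obtain p where "a - \<iota> q * u = \<iota> p" by (auto simp: V.span_singleton)
  then show ?thesis by (intro that[of p q]) (simp add: algebra_simps)
qed

lemma aut_moves:
  assumes "u \<notin> range \<iota>"
  shows "\<sigma> u \<noteq> u"
proof
  assume u: "\<sigma> u = u"
  have "\<sigma> a = a" for a
    by (rule basis_one_and[OF assms, of a]) (simp add: aut_add aut_mult aut_fixes u)
  then show False using aut_nontrivial by (simp add: fun_eq_iff)
qed

text \<open>
  A moved element \<open>u\<close> and its image are the two roots of one quadratic polynomial over \<open>F\<close>. So they
  add up to the negative of its linear coefficient, and \<open>\<sigma>\<close> exchanges them.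
\<close>

lemma aut_involution: "\<sigma> (\<sigma> a) = a"
proof -
  obtain u where u: "\<sigma> u \<noteq> u" using aut_nontrivial by (auto simp: fun_eq_iff)
  then have uF: "u \<notin> range \<iota>" using aut_fixes by auto
  obtain r s where rs: "u * u = \<iota> r + \<iota> s * u" by (rule basis_one_and[OF uF])
  then have "\<sigma> u * \<sigma> u = \<iota> r + \<iota> s * \<sigma> u"
    by (metis aut_add aut_fixes aut_mult)
  with rs have "(\<sigma> u - u) * (\<sigma> u + u - \<iota> s) = 0" by algebra
  with u have eq: "\<sigma> u + u = \<iota> s" by simp
  then have "\<sigma> (\<sigma> u) + \<sigma> u = \<iota> s" by (metis aut_add aut_fixes)
  with eq have uu: "\<sigma> (\<sigma> u) = u" by (metis add.commute add_left_cancel)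
  show ?thesis
    by (rule basis_one_and[OF uF, of a]) (simp add: aut_add aut_mult aut_fixes uu)
qed

end

section \<open>Right division and orbits as graphs\<close>

locale moving_involution =
  fixes \<sigma> :: "'e::field \<Rightarrow> 'e" and \<omega> :: 'e
  assumes conj_add: "\<sigma> (a + b) = \<sigma> a + \<sigma> b"
    and conj_mult: "\<sigma> (a * b) = \<sigma> a * \<sigma> b"
    and conj_conj [simp]: "\<sigma> (\<sigma> a) = a"
    and conj_moves: "\<sigma> \<omega> \<noteq> \<omega>"
begin

lemma conj_zero [simp]: "\<sigma> 0 = 0"
  by (metis add_0 add_cancel_right_left conj_add)

lemma conj_eq_zero [simp]: "\<sigma> a = 0 \<longleftrightarrow> a = 0"
  by (metis conj_conj conj_zero)

lemma conj_eq_iff [simp]: "\<sigma> a = \<sigma> b \<longleftrightarrow> a = b"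
  by (metis conj_conj)

lemma conj_diff: "\<sigma> (a - b) = \<sigma> a - \<sigma> b"
  using conj_add[of "a - b" b] by (simp add: algebra_simps)

lemma conj_one [simp]: "\<sigma> 1 = 1"
  using conj_mult[of 1 1] conj_eq_zero[of 1] by simp

lemmas conj_simps = conj_add conj_diff conj_mult

definition herm :: "'e \<times> 'e \<Rightarrow> 'e \<times> 'e \<Rightarrow> 'e" where
  "herm x y = \<sigma> (fst x) * fst y - \<omega> * \<sigma> (snd x) * snd y"

definition wedge :: "'e \<times> 'e \<Rightarrow> 'e \<times> 'e \<Rightarrow> 'e" where
  "wedge x y = fst x * snd y - snd x * fst y"

text \<open>
  Linear independence of \<open>1\<close> and \<open>\<omega>\<close> over the fixed field of \<open>\<sigma>\<close>, in a form that also applies to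
  \<open>p\<close> and \<open>q\<close> outside the fixed field, provided that the conjugate relation is known too.
\<close>

lemma coefficients_zero:
  assumes "p = \<omega> * q" and "p = \<sigma> \<omega> * q"
  shows "p = 0" "q = 0"
proof -
  have "(\<sigma> \<omega> - \<omega>) * q = 0" using assms by algebra
  then show "q = 0" using conj_moves by simp
  then show "p = 0" using assms by simp
qed

text \<open>
  The conjugate of \<open>herm y x\<close> is \<open>herm x y\<close> with \<open>\<sigma> \<omega>\<close> in place of \<open>\<omega>\<close>, so the two values
  together determine both summands of \<open>herm x y\<close>.
\<close>

lemma herm_coefficients:
  assumes "\<sigma> t = t" and "herm x' y' = t * herm x y" and "herm y' x' = t * herm y x"
  shows "\<sigma> (fst x') * fst y' = t * (\<sigma> (fst x) * fst y)"
    and "\<sigma> (snd x') * snd y' = t * (\<sigma> (snd x) * snd y)"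
proof -
  let ?p = "\<sigma> (fst x') * fst y' - t * (\<sigma> (fst x) * fst y)"
  let ?q = "\<sigma> (snd x') * snd y' - t * (\<sigma> (snd x) * snd y)"
  have 1: "?p = \<omega> * ?q"
    using assms(2) unfolding herm_def by algebra
  have "\<sigma> (herm y' x') = \<sigma> (t * herm y x)" using assms(3) by simp
  then have 2: "?p = \<sigma> \<omega> * ?q"
    unfolding herm_def by (simp add: conj_simps assms(1)) algebra
  show "\<sigma> (fst x') * fst y' = t * (\<sigma> (fst x) * fst y)"
    using coefficients_zero(1)[OF 1 2] by simp
  show "\<sigma> (snd x') * snd y' = t * (\<sigma> (snd x) * snd y)"
    using coefficients_zero(2)[OF 1 2] by simp
qed

lemma herm_self_nonzero:
  assumes "x \<noteq> 0"
  shows "herm x x \<noteq> 0"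
proof
  assume "herm x x = 0"
  then have "\<sigma> (fst x) * fst x = 0" "\<sigma> (snd x) * snd x = 0"
    using herm_coefficients[of 1 x x 0 0] by (simp_all add: herm_def)
  then show False using assms by (simp add: prod_eq_iff)
qed

text \<open>Cramer's rule for right multiplication by \<open>x\<close> in the coordinates \<open>fst a\<close> and \<open>\<sigma> (snd a)\<close>.\<close>

lemma A_mult_eq_iff:
  assumes "x \<noteq> 0"
  shows "A_mult \<sigma> \<omega> a x = z \<longleftrightarrow>
    herm x x * fst a = \<sigma> (fst x) * fst z - \<omega> * snd x * \<sigma> (snd z) \<and>
    herm x x * \<sigma> (snd a) = fst x * \<sigma> (snd z) - \<sigma> (snd x) * fst z"
    (is "_ \<longleftrightarrow> ?L \<and> ?R")
proof -
  obtain c d p q a1 a2 where eqs: "x = (c, d)" "z = (p, q)" "a = (a1, a2)"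
    by (metis surj_pair)
  have "A_mult \<sigma> \<omega> a x = z \<longleftrightarrow> a1 * c + \<omega> * \<sigma> a2 * d = p \<and> \<sigma> (a2 * c + \<sigma> a1 * d) = \<sigma> q"
    by (simp add: A_mult_def eqs)
  also have "\<dots> \<longleftrightarrow> a1 * c + \<omega> * \<sigma> a2 * d = p \<and> \<sigma> a2 * \<sigma> c + a1 * \<sigma> d = \<sigma> q"
    by (simp only: conj_simps conj_conj)
  also have "\<dots> \<longleftrightarrow> ?L \<and> ?R"
  proof safe
    assume h: "p = a1 * c + \<omega> * \<sigma> a2 * d" "\<sigma> a2 * \<sigma> c + a1 * \<sigma> d = \<sigma> q"
    show ?L unfolding eqs herm_def using h by simp algebra
    show ?R unfolding eqs herm_def using h by simp algebra
  next
    assume h: ?L ?R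
    have n: "herm x x \<noteq> 0" by (rule herm_self_nonzero[OF assms])
    have "herm x x * (a1 * c + \<omega> * \<sigma> a2 * d) = herm x x * p"
      using h unfolding eqs herm_def by simp algebra
    then show "a1 * c + \<omega> * \<sigma> a2 * d = p" using n by simp
    have "herm x x * (\<sigma> a2 * \<sigma> c + a1 * \<sigma> d) = herm x x * \<sigma> q"
      using h unfolding eqs herm_def by simp algebra
    then show "\<sigma> a2 * \<sigma> c + a1 * \<sigma> d = \<sigma> q" using n by simp
  qed
  finally show ?thesis .
qed

lemma A_mult_right_surj:
  assumes "x \<noteq> 0"
  obtains a where "A_mult \<sigma> \<omega> a x = z"
proof
  show "A_mult \<sigma> \<omega>
     ((\<sigma> (fst x) * fst z - \<omega> * snd x * \<sigma> (snd z)) / herm x x,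
      \<sigma> ((fst x * \<sigma> (snd z) - \<sigma> (snd x) * fst z) / herm x x)) x = z"
    by (simp add: A_mult_eq_iff[OF assms] herm_self_nonzero[OF assms])
qed

lemma pair_orbit_mem:
  "(z, w) \<in> pair_orbit m (x, y) \<longleftrightarrow> (\<exists>a. m a x = z \<and> m a y = w)"
  by (auto simp: pair_orbit_def pair_action_def)

text \<open>
  The orbit is the graph of right division by \<open>x\<close> followed by right multiplication by \<open>y\<close>. In the
  coordinates \<open>fst\<close> and \<open>\<sigma> \<circ> snd\<close> this map has the matrix entries on the right-hand side, divided by
  \<open>herm x x\<close>.
\<close>

lemma pair_orbit_iff:
  assumes "x \<noteq> 0"
  shows "(z, w) \<in> pair_orbit (A_mult \<sigma> \<omega>) (x, y) \<longleftrightarrow>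
    herm x x * fst w = herm x y * fst z + \<omega> * wedge x y * \<sigma> (snd z) \<and>
    herm x x * \<sigma> (snd w) = \<sigma> (wedge x y) * fst z + herm y x * \<sigma> (snd z)"
    (is "_ \<longleftrightarrow> ?R")
proof -
  obtain a where a: "A_mult \<sigma> \<omega> a x = z" by (rule A_mult_right_surj[OF assms])
  have n: "herm x x \<noteq> 0" by (rule herm_self_nonzero[OF assms])
  note cr = a[unfolded A_mult_eq_iff[OF assms]]
  have uniq: "b = a" if "A_mult \<sigma> \<omega> b x = z" for b
  proof -
    have "herm x x * fst b = herm x x * fst a" "herm x x * \<sigma> (snd b) = herm x x * \<sigma> (snd a)"
      using that cr unfolding A_mult_eq_iff[OF assms] by simp_all
    then show ?thesis using n by (simp add: prod_eq_iff)
  qed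
  then have "(z, w) \<in> pair_orbit (A_mult \<sigma> \<omega>) (x, y) \<longleftrightarrow> w = A_mult \<sigma> \<omega> a y"
    using a unfolding pair_orbit_mem by metis
  also have "\<dots> \<longleftrightarrow> fst w = fst a * fst y + \<omega> * \<sigma> (snd a) * snd y \<and>
      \<sigma> (snd w) = \<sigma> (snd a * fst y + \<sigma> (fst a) * snd y)"
    by (simp add: A_mult_def prod_eq_iff split_beta)
  also have "\<dots> \<longleftrightarrow> herm x x * fst w = herm x x * (fst a * fst y + \<omega> * \<sigma> (snd a) * snd y) \<and>
      herm x x * \<sigma> (snd w) = herm x x * (\<sigma> (snd a) * \<sigma> (fst y) + fst a * \<sigma> (snd y))"
    by (simp only: conj_simps conj_conj mult_cancel_left n simp_thms)
  also have "herm x x * (fst a * fst y + \<omega> * \<sigma> (snd a) * snd y) =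
      herm x y * fst z + \<omega> * wedge x y * \<sigma> (snd z)"
    using cr unfolding herm_def[of x y] wedge_def by algebra
  also have "herm x x * (\<sigma> (snd a) * \<sigma> (fst y) + fst a * \<sigma> (snd y)) =
      \<sigma> (wedge x y) * fst z + herm y x * \<sigma> (snd z)"
    using cr unfolding herm_def[of y x] wedge_def by (simp only: conj_simps) algebra
  finally show ?thesis .
qed

text \<open>
  The two columns of the matrix are read off at \<open>z = (1, 0)\<close> and \<open>z = (0, 1)\<close>.
\<close>

lemma pair_orbit_eqD:
  assumes "x \<noteq> 0" "x' \<noteq> 0"
    and "pair_orbit (A_mult \<sigma> \<omega>) (x, y) = pair_orbit (A_mult \<sigma> \<omega>) (x', y')"
  obtains t where "t \<noteq> 0" "herm x' x' = t * herm x x" "herm x' y' = t * herm x y"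
    "herm y' x' = t * herm y x" "wedge x' y' = t * wedge x y"
    "\<sigma> (wedge x' y') = t * \<sigma> (wedge x y)"
proof
  let ?t = "herm x' x' / herm x x"
  have n: "herm x x \<noteq> 0" "herm x' x' \<noteq> 0"
    using assms herm_self_nonzero by auto
  have "\<omega> \<noteq> 0" using conj_moves by auto
  show "?t \<noteq> 0" "herm x' x' = ?t * herm x x" using n by simp_all
  have "((1, 0), (herm x y / herm x x, \<sigma> (\<sigma> (wedge x y) / herm x x)))
      \<in> pair_orbit (A_mult \<sigma> \<omega>) (x, y)"
    using n by (simp add: pair_orbit_iff[OF assms(1)])
  then show "herm x' y' = ?t * herm x y" "\<sigma> (wedge x' y') = ?t * \<sigma> (wedge x y)"
    unfolding assms(3) by (simp_all add: pair_orbit_iff[OF assms(2)])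
  have "((0, 1), (\<omega> * wedge x y / herm x x, \<sigma> (herm y x / herm x x)))
      \<in> pair_orbit (A_mult \<sigma> \<omega>) (x, y)"
    using n by (simp add: pair_orbit_iff[OF assms(1)])
  then have "herm y' x' = ?t * herm y x" "\<omega> * wedge x' y' = \<omega> * (?t * wedge x y)"
    unfolding assms(3) by (simp_all add: pair_orbit_iff[OF assms(2)] mult_ac)
  then show "herm y' x' = ?t * herm y x" "wedge x' y' = ?t * wedge x y"
    using \<open>\<omega> \<noteq> 0\<close> by (simp_all only: mult_cancel_left simp_thms)
qed

section \<open>Comparing two orbits\<close>

lemma wedge_eq_zeroD:
  assumes "x \<noteq> 0" "y \<noteq> 0" "wedge x y = 0"
  obtains m where "m \<noteq> 0" "x = A_rscale y m"
proof -
  obtain c d e f where eqs: "x = (c, d)" "y = (e, f)" by (metis surj_pair)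
  have D: "c * f = d * e" using assms(3) by (simp add: wedge_def eqs)
  have "\<exists>m. x = A_rscale y m"
  proof (cases "e = 0")
    case True
    with assms(2) D have "f \<noteq> 0" "c = 0" by (auto simp: eqs zero_prod_def)
    with True show ?thesis by (intro exI[of _ "d / f"]) (simp add: A_rscale_def eqs)
  next
    case False
    with D show ?thesis by (intro exI[of _ "c / e"]) (simp add: A_rscale_def eqs field_simps)
  qed
  moreover have "A_rscale y 0 = 0" by (simp add: A_rscale_def split_beta zero_prod_def)
  ultimately show ?thesis using assms(1) that by metis
qed

text \<open>For \<open>x = y m\<close> the ratio \<open>herm x x / herm y x\<close> recovers \<open>\<sigma> m\<close>.\<close>

lemma proportional_case:
  assumes "y \<noteq> 0" "y' \<noteq> 0" "m \<noteq> 0" "m' \<noteq> 0" "t \<noteq> 0"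
    and "x = A_rscale y m" "x' = A_rscale y' m'"
    and "herm x' x' = t * herm x x" "herm y' x' = t * herm y x"
  shows "m' = m"
proof -
  have self: "herm (A_rscale y m) (A_rscale y m) = \<sigma> m * herm y (A_rscale y m)" for y m
    by (simp add: herm_def A_rscale_def split_beta conj_simps algebra_simps)
  have mixed: "herm y (A_rscale y m) = herm y y * m" for y m
    by (simp add: herm_def A_rscale_def split_beta algebra_simps)
  have "herm y' x' \<noteq> 0"
    unfolding assms mixed using assms herm_self_nonzero by simp
  moreover have "\<sigma> m' * herm y' x' = \<sigma> m * herm y' x'"
    using assms(8,9) self[of y m] self[of y' m'] assms(6,7) by (simp add: mult_ac)
  ultimately show ?thesis by simp
qed

text \<open>
  The factor can only be \<open>c' / c\<close>. The norm condition says that it has norm \<open>t\<close>, and cancelling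
  \<open>\<sigma> c'\<close> in the last hypothesis carries it over from \<open>c\<close> to \<open>e\<close>. This is applied both to the first
  and to the second coordinates of \<open>x\<close> and \<open>y\<close>.
\<close>

lemma common_factor:
  assumes "c \<noteq> 0" "t \<noteq> 0" "\<sigma> c' * c' = t * (\<sigma> c * c)" "\<sigma> c' * e' = t * (\<sigma> c * e)"
  obtains l where "l \<noteq> 0" "\<sigma> l * l = t" "c' = l * c" "e' = l * e"
proof
  let ?l = "c' / c"
  show c': "c' = ?l * c" using assms(1) by simp
  have c0: "c' \<noteq> 0" using assms by auto
  then show "?l \<noteq> 0" using assms(1) by simp
  have sc: "\<sigma> c' = \<sigma> ?l * \<sigma> c" by (metis c' conj_mult)
  have "(\<sigma> ?l * ?l) * (\<sigma> c * c) = t * (\<sigma> c * c)"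
    using assms(3) c' sc by (metis mult.assoc mult.left_commute)
  then show t: "\<sigma> ?l * ?l = t" using assms(1) by simp
  have "\<sigma> c' * e' = (\<sigma> ?l * ?l) * (\<sigma> c * e)"
    using assms(4) t by simp
  also have "\<dots> = \<sigma> c' * (?l * e)"
    by (simp only: sc mult_ac)
  finally show "e' = ?l * e" using c0 by (simp only: mult_cancel_left conj_eq_zero simp_thms)
qed

text \<open>
  The factors of the first and of the second coordinates are tied together by the alternating form.
  When a coordinate of \<open>x\<close> vanishes, its factor is not determined by \<open>x\<close>, and the alternating form gives
  the factor for that coordinate of \<open>y\<close> instead.
\<close>

lemma independent_case:
  assumes "t \<noteq> 0" "wedge x y \<noteq> 0"
    and "herm x' x' = t * herm x x" "herm x' y' = t * herm x y" "herm y' x' = t * herm y x"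
    and w: "wedge x' y' = t * wedge x y" and "\<sigma> (wedge x' y') = t * \<sigma> (wedge x y)"
  obtains l where "l \<noteq> 0" "x' = A_lscale \<sigma> l x" "y' = A_lscale \<sigma> l y"
proof -
  obtain c d e f c' d' e' f' where
    eqs: "x = (c, d)" "y = (e, f)" "x' = (c', d')" "y' = (e', f')"
    by (metis surj_pair)
  have t: "\<sigma> t = t"
    using assms(2,7) by (simp add: w conj_mult)
  note xx = herm_coefficients[OF t assms(3,3), unfolded eqs fst_conv snd_conv]
  note xy = herm_coefficients[OF t assms(4,5), unfolded eqs fst_conv snd_conv]
  have D: "c' * f' - d' * e' = t * (c * f - d * e)" and D0: "c * f - d * e \<noteq> 0"
    using w assms(2) by (simp_all add: wedge_def eqs)
  have "\<exists>l. l \<noteq> 0 \<and> c' = l * c \<and> e' = l * e \<and> d' = \<sigma> l * d \<and> f' = \<sigma> l * f"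
  proof (cases "c = 0")
    case False
    obtain l where l: "l \<noteq> 0" "\<sigma> l * l = t" "c' = l * c" "e' = l * e"
      by (rule common_factor[OF False assms(1) xx(1) xy(1)])
    show ?thesis
    proof (cases "d = 0")
      case True
      then have "d' = 0" using xx(2) by simp
      with True D l(2,3) have "(l * c) * f' = (l * c) * (\<sigma> l * f)" by algebra
      with l \<open>d' = 0\<close> True False show ?thesis by auto
    next
      case False
      obtain k where k: "k \<noteq> 0" "\<sigma> k * k = t" "d' = k * d" "f' = k * f"
        by (rule common_factor[OF False assms(1) xx(2) xy(2)])
      have "(k * l) * (c * f - d * e) = (\<sigma> l * l) * (c * f - d * e)"
        using D l k by algebra
      then have "k = \<sigma> l" using D0 l(1) by simp
      with l k show ?thesis by auto
    qed
  next
    case True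
    then have "c' = 0" using xx(1) by simp
    have "d \<noteq> 0" using D0 True by auto
    obtain k where k: "k \<noteq> 0" "\<sigma> k * k = t" "d' = k * d" "f' = k * f"
      by (rule common_factor[OF \<open>d \<noteq> 0\<close> assms(1) xx(2) xy(2)])
    have "(k * d) * e' = (k * d) * (\<sigma> k * e)" using D True \<open>c' = 0\<close> k(2,3) by algebra
    then have "e' = \<sigma> k * e" using k(1) \<open>d \<noteq> 0\<close> by simp
    with k True \<open>c' = 0\<close> show ?thesis by (intro exI[of _ "\<sigma> k"]) simp
  qed
  then show ?thesis using that by (auto simp: A_lscale_def eqs)
qed

text \<open>The two scalings are compatible with the multiplication as in an associative algebra.\<close>

lemma A_mult_lscale: "A_mult \<sigma> \<omega> a (A_lscale \<sigma> l x) = A_mult \<sigma> \<omega> (A_rscale a l) x"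
  by (simp add: A_mult_def A_lscale_def A_rscale_def split_beta conj_simps algebra_simps)

lemma A_mult_rscale: "A_mult \<sigma> \<omega> a (A_rscale x m) = A_rscale (A_mult \<sigma> \<omega> a x) m"
  by (simp add: A_mult_def A_rscale_def split_beta algebra_simps)

lemma pair_orbit_lscale:
  assumes "l \<noteq> 0"
  shows "pair_orbit (A_mult \<sigma> \<omega>) (A_lscale \<sigma> l x, A_lscale \<sigma> l y) = pair_orbit (A_mult \<sigma> \<omega>) (x, y)"
proof -
  have "surj (\<lambda>a. A_rscale a l)"
    by (rule surjI[of _ "\<lambda>a. A_rscale a (inverse l)"])
      (simp add: A_rscale_def split_beta assms mult.assoc)
  then have "(\<exists>a. P (A_rscale a l)) \<longleftrightarrow> (\<exists>a. P a)" for P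
    by (metis surjD)
  from this[of "\<lambda>a. p = (A_mult \<sigma> \<omega> a x, A_mult \<sigma> \<omega> a y)" for p] show ?thesis
    by (simp add: pair_orbit_def pair_action_def A_mult_lscale)
qed

text \<open>Since \<open>A y = A\<close>, the orbit of \<open>(y m, y)\<close> does not depend on \<open>y\<close>.\<close>

lemma pair_orbit_rscale:
  assumes "y \<noteq> 0"
  shows "pair_orbit (A_mult \<sigma> \<omega>) (A_rscale y m, y) = range (\<lambda>z. (A_rscale z m, z))"
proof (intro set_eqI iffI)
  fix p assume "p \<in> pair_orbit (A_mult \<sigma> \<omega>) (A_rscale y m, y)"
  then show "p \<in> range (\<lambda>z. (A_rscale z m, z))"
    unfolding pair_orbit_def pair_action_def by (auto simp: A_mult_rscale)
next
  fix p assume "p \<in> range (\<lambda>z. (A_rscale z m, z))"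
  then obtain z where z: "p = (A_rscale z m, z)" by auto
  obtain a where "A_mult \<sigma> \<omega> a y = z" by (rule A_mult_right_surj[OF assms])
  then show "p \<in> pair_orbit (A_mult \<sigma> \<omega>) (A_rscale y m, y)"
    unfolding z pair_orbit_mem A_mult_rscale by blast
qed

lemma pair_orbit_eq_iff:
  assumes "x \<noteq> 0" "y \<noteq> 0" "x' \<noteq> 0" "y' \<noteq> 0"
  shows "pair_orbit (A_mult \<sigma> \<omega>) (x, y) = pair_orbit (A_mult \<sigma> \<omega>) (x', y') \<longleftrightarrow>
    (\<exists>l. l \<noteq> 0 \<and> x' = A_lscale \<sigma> l x \<and> y' = A_lscale \<sigma> l y) \<or>
    (\<exists>m. m \<noteq> 0 \<and> x = A_rscale y m \<and> x' = A_rscale y' m)"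
proof
  assume "pair_orbit (A_mult \<sigma> \<omega>) (x, y) = pair_orbit (A_mult \<sigma> \<omega>) (x', y')"
  then obtain t where t: "t \<noteq> 0" "herm x' x' = t * herm x x" "herm x' y' = t * herm x y"
    "herm y' x' = t * herm y x" "wedge x' y' = t * wedge x y"
    "\<sigma> (wedge x' y') = t * \<sigma> (wedge x y)"
    by (rule pair_orbit_eqD[OF assms(1,3)])
  show "(\<exists>l. l \<noteq> 0 \<and> x' = A_lscale \<sigma> l x \<and> y' = A_lscale \<sigma> l y) \<or>
    (\<exists>m. m \<noteq> 0 \<and> x = A_rscale y m \<and> x' = A_rscale y' m)"
  proof (cases "wedge x y = 0")
    case True
    then have "wedge x' y' = 0" using t(5) by simp
    obtain m where m: "m \<noteq> 0" "x = A_rscale y m"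
      by (rule wedge_eq_zeroD[OF assms(1,2) True])
    obtain m' where m': "m' \<noteq> 0" "x' = A_rscale y' m'"
      by (rule wedge_eq_zeroD[OF assms(3,4) \<open>wedge x' y' = 0\<close>])
    have "m' = m"
      by (rule proportional_case[OF assms(2,4) m(1) m'(1) t(1) m(2) m'(2) t(2,4)])
    then show ?thesis using m m' by blast
  next
    case False
    show ?thesis by (rule independent_case[OF t(1) False t(2-6)]) blast
  qed
next
  assume "(\<exists>l. l \<noteq> 0 \<and> x' = A_lscale \<sigma> l x \<and> y' = A_lscale \<sigma> l y) \<or>
    (\<exists>m. m \<noteq> 0 \<and> x = A_rscale y m \<and> x' = A_rscale y' m)"
  then show "pair_orbit (A_mult \<sigma> \<omega>) (x, y) = pair_orbit (A_mult \<sigma> \<omega>) (x', y')"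
    by (auto simp: pair_orbit_lscale pair_orbit_rscale assms(2,4))
qed

end

theorem theorem2p2:
  fixes \<iota> :: "'f::field \<Rightarrow> 'e::field"
    and \<sigma> :: "'e \<Rightarrow> 'e"
    and \<omega> :: 'e
    and x y x' y' :: "'e \<times> 'e"
  assumes "quadratic_extension \<iota> \<sigma>"
    and "\<omega> \<notin> range \<iota>"
    and "x \<noteq> 0" and "y \<noteq> 0" and "x' \<noteq> 0" and "y' \<noteq> 0"
  shows "pair_orbit (A_mult \<sigma> \<omega>) (x, y) = pair_orbit (A_mult \<sigma> \<omega>) (x', y') \<longleftrightarrow>
    (\<exists>l. l \<noteq> 0 \<and> x' = A_lscale \<sigma> l x \<and> y' = A_lscale \<sigma> l y) \<or>
    (\<exists>m. m \<noteq> 0 \<and> x = A_rscale y m \<and> x' = A_rscale y' m)"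
proof -
  interpret quadratic_extension \<iota> \<sigma> by (rule assms(1))
  interpret moving_involution \<sigma> \<omega>
    by unfold_locales (simp_all add: aut_add aut_mult aut_involution aut_moves[OF assms(2)])
  show ?thesis by (rule pair_orbit_eq_iff[OF assms(3-6)])
qed

end
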